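(* Let $n\ge1$, $l\ge-(n-1)$, and consider the loss $\rho_{c_1,c_2}\left(\frac{d-\mu}{\sigma}\right)$ with $\rho_{c_1,c_2}(t)=c_1|t|^p1_{(-\infty,0)}(t)+c_2|t|^p1_{[0,\infty)}(t)$, $p>0$, $c_1>0$, $c_2>0$. Then the generalized Bayes estimator $\delta_{\pi_l}$ of $\mu$ does not depend on the underlying model density $f$, provided it exists; that is, any two functions $f$ satisfying the model assumptions for which $\delta_{\pi_l}$ exists give the same estimator $\delta_{\pi_l}(x,s)$ for all $(x,s)\in\mathbb{R}\times(0,\infty)$.
   Context: Model: $f:\mathbb{R}^+\to\mathbb{R}^+$ is a known differentiable function with $f'<0$ and $tf'(t)/f(t)$ decreasing in $t$ for $t>0$, and $(X,S)\in\mathbb{R}\times(0,\infty)$ has joint density $\frac{s^{n-1}}{\sigma^{n+1}}f\left(\frac{(x-\mu)^2+s^2}{\sigma^2}\right)$ ($f$ suitably normalized), with $\mu\ge0$, $\sigma>0$. For $l\ge-(n-1)$, $\delta_{\pi_l}$ denotes the generalized Bayes estimator of $\mu$ with respect to the prior $\pi_l(\mu,\sigma)=\sigma^{-(l+1)}1_{[0,\infty)}(\mu)1_{(0,\infty)}(\sigma)$, i.e. $\delta_{\pi_l}(x,s)$ is the (uniquely determined) minimizer in $d$ of $\int_0^\infty\int_0^\infty\rho_{c_1,c_2}\left(\frac{d-\mu}{\sigma}\right)\frac{s^{n-1}}{\sigma^{n+1}}f\left(\frac{(x-\mu)^2+s^2}{\sigma^2}\right)\frac{1}{\sigma^{l+1}}\,d\mu\,d\sigma$.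 "Exists" means that this integral is finite for suitable $d$ and such a minimizer exists. *)

theory Defs
  imports "HOL-Probability.Probability"
begin

text \<open>Only the values of \<open>f\<close> on \<open>{0<..}\<close> matter throughout: the argument of \<open>f\<close> is positive
  whenever \<open>s > 0\<close> and \<open>\<sigma> > 0\<close>.\<close>

definition model_pdf :: "nat \<Rightarrow> (real \<Rightarrow> real) \<Rightarrow> real \<Rightarrow> real \<Rightarrow> real \<Rightarrow> real \<Rightarrow> real" where
  "model_pdf n f \<mu> \<sigma> x s = s ^ (n - 1) / \<sigma> ^ (n + 1) * f (((x - \<mu>)\<^sup>2 + s\<^sup>2) / \<sigma>\<^sup>2)"

text \<open>The last conjunct says that \<open>f\<close> is normalized, so that \<open>model_pdf\<close> is a probability density
  of \<open>(X, S)\<close> on the half-plane \<open>UNIV \<times> {0<..}\<close>. ``Decreasing'' is read in the weak sense.\<close>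

definition admissible_model :: "nat \<Rightarrow> (real \<Rightarrow> real) \<Rightarrow> bool" where
  "admissible_model n f \<longleftrightarrow>
     (\<forall>t>0. f t > 0) \<and>
     (\<forall>t>0. f differentiable at t) \<and>
     (\<forall>t>0. deriv f t < 0) \<and>
     antimono_on {0<..} (\<lambda>t. t * deriv f t / f t) \<and>
     (\<forall>\<mu>\<ge>0. \<forall>\<sigma>>0. prob_space (density lborel
        (\<lambda>(x, s). ennreal (model_pdf n f \<mu> \<sigma> x s) * indicator {0<..} s)))"

definition rho :: "real \<Rightarrow> real \<Rightarrow> real \<Rightarrow> real \<Rightarrow> real" where
  "rho c1 c2 p t =
     c1 * \<bar>t\<bar> powr p * indicator {..<0} t + c2 * \<bar>t\<bar> powr p * indicator {0..} t"

text \<open>Posterior expected loss of the decision \<open>d\<close>, up to the normalizing factor of the posterior,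
  under the prior density \<open>1 / \<sigma> powr (l + 1)\<close> on \<open>{0..} \<times> {0<..}\<close>. The integrand is nonnegative,
  so the integral is taken in \<open>ennreal\<close> and may be infinite.\<close>

definition posterior_loss ::
  "nat \<Rightarrow> real \<Rightarrow> (real \<Rightarrow> real) \<Rightarrow> (real \<Rightarrow> real) \<Rightarrow> real \<Rightarrow> real \<Rightarrow> real \<Rightarrow> ennreal" where
  "posterior_loss n l \<rho> f x s d =
     (\<integral>\<^sup>+\<sigma>\<in>{0<..}. (\<integral>\<^sup>+\<mu>\<in>{0..}.
        ennreal (\<rho> ((d - \<mu>) / \<sigma>) * model_pdf n f \<mu> \<sigma> x s * (1 / \<sigma> powr (l + 1)))
      \<partial>lborel) \<partial>lborel)"

definition is_bayes_action ::
  "nat \<Rightarrow> real \<Rightarrow> (real \<Rightarrow> real) \<Rightarrow> (real \<Rightarrow> real) \<Rightarrow> real \<Rightarrow> real \<Rightarrow> real \<Rightarrow> bool" where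
  "is_bayes_action n l \<rho> f x s d \<longleftrightarrow>
     (\<forall>d'. posterior_loss n l \<rho> f x s d \<le> posterior_loss n l \<rho> f x s d')"

definition gen_bayes_exists ::
  "nat \<Rightarrow> real \<Rightarrow> (real \<Rightarrow> real) \<Rightarrow> (real \<Rightarrow> real) \<Rightarrow> bool" where
  "gen_bayes_exists n l \<rho> f \<longleftrightarrow>
     (\<forall>x. \<forall>s>0. (\<exists>d. posterior_loss n l \<rho> f x s d < \<infinity>) \<and> (\<exists>!d. is_bayes_action n l \<rho> f x s d))"

definition gen_bayes ::
  "nat \<Rightarrow> real \<Rightarrow> (real \<Rightarrow> real) \<Rightarrow> (real \<Rightarrow> real) \<Rightarrow> real \<Rightarrow> real \<Rightarrow> real" where
  "gen_bayes n l \<rho> f x s = (THE d. is_bayes_action n l \<rho> f x s d)"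

end

theory Submission
  imports Defs
begin

text \<open>The loss is homogeneous, so for \<open>\<sigma> > 0\<close> the integrand is a function of \<open>\<mu>\<close> times
  \<open>\<sigma> powr - q * f (((x - \<mu>)\<^sup>2 + s\<^sup>2) / \<sigma>\<^sup>2)\<close> with \<open>q = p + n + l + 2\<close>. Integrating over \<open>\<sigma>\<close> first and
  rescaling \<open>\<sigma> = sqrt ((x - \<mu>)\<^sup>2 + s\<^sup>2) * \<tau>\<close> turns \<open>f\<close> into a constant factor, which
  must be positive and finite if a unique minimizer with finite loss exists.\<close>

definition mixing_const :: "real \<Rightarrow> (real \<Rightarrow> real) \<Rightarrow> ennreal" where
  "mixing_const q f = (\<integral>\<^sup>+\<tau>\<in>{0<..}. ennreal (\<tau> powr - q * f (1 / \<tau>\<^sup>2)) \<partial>lborel)"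

text \<open>What is left after integrating out \<sigma>: an expression free of \<open>f\<close>. In
  the exponent \<open>1 - q\<close>, the \<open>-q\<close> comes from the power of \<sigma> and the
  1 from the Jacobian of the rescaling.\<close>

definition reduced_loss :: "nat \<Rightarrow> real \<Rightarrow> (real \<Rightarrow> real) \<Rightarrow> real \<Rightarrow> real \<Rightarrow> real \<Rightarrow> ennreal" where
  "reduced_loss n q \<rho> x s d =
     (\<integral>\<^sup>+\<mu>\<in>{0..}. ennreal (\<rho> (d - \<mu>) * s ^ (n - 1) * sqrt ((x - \<mu>)\<^sup>2 + s\<^sup>2) powr (1 - q)) \<partial>lborel)"

lemma rho_nonneg:
  assumes "c1 > 0" "c2 > 0"
  shows "rho c1 c2 p t \<ge> 0"
  using assms by (simp add: rho_def)

lemma rho_pos: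
  assumes "c1 > 0" "c2 > 0" "t \<noteq> 0"
  shows "rho c1 c2 p t > 0"
  using assms by (auto simp: rho_def indicator_def not_less)

lemma rho_scale:
  assumes "\<sigma> > 0"
  shows "rho c1 c2 p (t / \<sigma>) = rho c1 c2 p t * \<sigma> powr - p"
  using assms
  by (simp add: rho_def indicator_def powr_divide powr_minus_divide abs_divide
      zero_le_divide_iff divide_less_0_iff)

lemma borel_measurable_rho [measurable]: "rho c1 c2 p \<in> borel_measurable borel"
  unfolding rho_def by measurable

text \<open>Nothing is assumed about \<open>f\<close> on nonpositive arguments, where it may fail to
  be measurable. Cutting it off there gives a Borel function on the whole line, as differentiability
  makes \<open>f\<close> continuous on the open half-line.\<close>

lemma borel_measurable_indicator_pos_reals:
  fixes f :: "real \<Rightarrow> real"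
  assumes "\<And>t. t > 0 \<Longrightarrow> f differentiable at t"
  shows "(\<lambda>t. indicator {0<..} t * f t) \<in> borel_measurable borel"
proof -
  have "continuous_on {0<..} f"
    using assms by (intro continuous_at_imp_continuous_on ballI)
      (simp add: differentiable_imp_continuous_within)
  then show ?thesis
    using borel_measurable_continuous_on_indicator[of "{0<..}" f] by simp
qed

text \<open>Substituting \<open>\<sigma> = sqrt a * \<tau>\<close> turns
  \<open>a / \<sigma>\<^sup>2\<close> into \<open>1 / \<tau>\<^sup>2\<close>, so \<open>a\<close>
  survives only as a power of its root.\<close>

lemma mixing_integral_scale:
  fixes f :: "real \<Rightarrow> real"
  assumes diff: "\<And>t. t > 0 \<Longrightarrow> f differentiable at t" and a: "a > 0"
  shows "(\<integral>\<^sup>+\<sigma>\<in>{0<..}. ennreal (\<sigma> powr - q * f (a / \<sigma>\<^sup>2)) \<partial>lborel)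
       = ennreal (sqrt a powr (1 - q)) * mixing_const q f"
proof -
  define h where "h = (\<lambda>t::real. indicator {0<..} t * f t)"
  have [measurable]: "h \<in> borel_measurable borel"
    unfolding h_def using diff by (rule borel_measurable_indicator_pos_reals)
  define b where "b = sqrt a"
  have b: "b > 0" "b\<^sup>2 = a" using a by (auto simp: b_def)
  \<comment> \<open>Passing to the measurable cutoff \<open>h\<close>; needed for
    \<open>c = a\<close> on the left and for \<open>c = 1\<close> inside
    \<open>mixing_const\<close>.\<close>
  have eq: "(\<integral>\<^sup>+\<sigma>\<in>{0<..}. ennreal (\<sigma> powr - q * f (c / \<sigma>\<^sup>2)) \<partial>lborel)
       = (\<integral>\<^sup>+\<sigma>. ennreal (\<sigma> powr - q * h (c / \<sigma>\<^sup>2)) * indicator {0<..} \<sigma> \<partial>lborel)"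
    if "c > 0" for c
    using that by (intro nn_integral_cong) (auto simp: h_def indicator_def)
  have pt: "ennreal ((b * \<tau>) powr - q * h (a / (b * \<tau>)\<^sup>2)) * indicator {0<..} (b * \<tau>)
    = ennreal (b powr - q) * (ennreal (\<tau> powr - q * h (1 / \<tau>\<^sup>2)) * indicator {0<..} \<tau>)" for \<tau>
  proof (cases "\<tau> > 0")
    case True
    then have "(b * \<tau>) powr - q * h (a / (b * \<tau>)\<^sup>2) = b powr - q * (\<tau> powr - q * h (1 / \<tau>\<^sup>2))"
      using a b by (simp add: powr_mult power_mult_distrib)
    with True b show ?thesis
      by (simp add: ennreal_mult' [symmetric])
  next
    case False
    then show ?thesis
      using b by (simp add: indicator_def zero_less_mult_iff)
  qed
  have "(\<integral>\<^sup>+\<sigma>. ennreal (\<sigma> powr - q * h (a / \<sigma>\<^sup>2)) * indicator {0<..} \<sigma> \<partial>lborel)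
    = ennreal b * (\<integral>\<^sup>+\<tau>. ennreal ((b * \<tau>) powr - q * h (a / (b * \<tau>)\<^sup>2)) * indicator {0<..} (b * \<tau>) \<partial>lborel)"
    using b by (subst nn_integral_real_affine[where c = b and t = 0]) auto
  also have "\<dots> = ennreal b * (\<integral>\<^sup>+\<tau>. ennreal (b powr - q) *
      (ennreal (\<tau> powr - q * h (1 / \<tau>\<^sup>2)) * indicator {0<..} \<tau>) \<partial>lborel)"
    by (simp only: pt)
  also have "\<dots> = ennreal b * (ennreal (b powr - q) *
      (\<integral>\<^sup>+\<tau>. ennreal (\<tau> powr - q * h (1 / \<tau>\<^sup>2)) * indicator {0<..} \<tau> \<partial>lborel))"
    by (subst nn_integral_cmult) auto
  also have "\<dots> = ennreal (b powr (1 - q)) *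
      (\<integral>\<^sup>+\<tau>. ennreal (\<tau> powr - q * h (1 / \<tau>\<^sup>2)) * indicator {0<..} \<tau> \<partial>lborel)"
    using b by (simp add: mult.assoc[symmetric] ennreal_mult' [symmetric] powr_diff powr_minus_divide)
  finally show ?thesis
    using eq[of a] eq[of 1] a by (simp add: mixing_const_def b_def)
qed

text \<open>The power of \<sigma> collects \<open>p\<close> from the homogeneous loss,
  \<open>n + 1\<close> from the model density and \<open>l + 1\<close> from the prior.\<close>

lemma posterior_loss_integrand:
  assumes "\<sigma> > 0"
  shows "rho c1 c2 p ((d - \<mu>) / \<sigma>) * model_pdf n f \<mu> \<sigma> x s * (1 / \<sigma> powr (l + 1))
    = rho c1 c2 p (d - \<mu>) * s ^ (n - 1) *
      (\<sigma> powr - (p + real n + l + 2) * f (((x - \<mu>)\<^sup>2 + s\<^sup>2) / \<sigma>\<^sup>2))"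
proof -
  have "\<sigma> powr - (p + real n + l + 2) = \<sigma> powr - p * (1 / \<sigma> ^ (n + 1)) * (1 / \<sigma> powr (l + 1))"
  proof -
    have "\<sigma> powr - (p + real n + l + 2) = \<sigma> powr (- p + - real (n + 1) + - (l + 1))"
      by (rule arg_cong[where f = "(powr) \<sigma>"]) simp
    also have "\<dots> = \<sigma> powr - p * \<sigma> powr - real (n + 1) * \<sigma> powr - (l + 1)"
      by (simp only: powr_add)
    also have "\<sigma> powr - real (n + 1) = 1 / \<sigma> ^ (n + 1)"
      using assms by (simp only: powr_minus_divide powr_realpow)
    finally show ?thesis
      by (simp only: powr_minus_divide)
  qed
  then show ?thesis
    using assms by (simp add: rho_scale model_pdf_def)
qed

lemma posterior_loss_factorization:
  fixes f :: "real \<Rightarrow> real" and n :: nat and l p :: real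
  assumes diff: "\<And>t. t > 0 \<Longrightarrow> f differentiable at t"
    and c: "c1 > 0" "c2 > 0" and s: "s > 0"
  defines "q \<equiv> p + real n + l + 2"
  shows "posterior_loss n l (rho c1 c2 p) f x s d
    = mixing_const q f * reduced_loss n q (rho c1 c2 p) x s d"
proof -
  define h where "h = (\<lambda>t::real. indicator {0<..} t * f t)"
  have [measurable]: "h \<in> borel_measurable borel"
    unfolding h_def using diff by (rule borel_measurable_indicator_pos_reals)
  define A where "A = (\<lambda>\<mu>. (x - \<mu>)\<^sup>2 + s\<^sup>2)"
  have A: "A \<mu> > 0" for \<mu> using s by (simp add: A_def add_nonneg_pos)
  have [measurable]: "A \<in> borel_measurable borel" unfolding A_def by measurable
  define w where "w = (\<lambda>\<mu>. rho c1 c2 p (d - \<mu>) * s ^ (n - 1))"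
  have w: "w \<mu> \<ge> 0" for \<mu> using c s by (simp add: w_def rho_nonneg)
  have [measurable]: "w \<in> borel_measurable borel" unfolding w_def by measurable
  \<comment> \<open>Both indicators and the cutoff \<open>h\<close> are built in, so that
    \<open>E\<close> is jointly Borel on the whole plane, as Tonelli's theorem requires. Since
    \<open>A \<mu> > 0\<close>, \<open>h\<close> agrees with \<open>f\<close> wherever \<sigma> is
    positive.\<close>
  define E where "E = (\<lambda>\<mu> \<sigma>. ennreal (w \<mu>) * indicator {0..} \<mu> *
      (ennreal (\<sigma> powr - q * h (A \<mu> / \<sigma>\<^sup>2)) * indicator {0<..} \<sigma>))"
  have "posterior_loss n l (rho c1 c2 p) f x s d = (\<integral>\<^sup>+\<sigma>. (\<integral>\<^sup>+\<mu>. E \<mu> \<sigma> \<partial>lborel) \<partial>lborel)"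
    unfolding posterior_loss_def
  proof (rule nn_integral_cong)
    fix \<sigma> :: real
    show "(\<integral>\<^sup>+\<mu>\<in>{0..}. ennreal (rho c1 c2 p ((d - \<mu>) / \<sigma>) * model_pdf n f \<mu> \<sigma> x s *
        (1 / \<sigma> powr (l + 1))) \<partial>lborel) * indicator {0<..} \<sigma> = (\<integral>\<^sup>+\<mu>. E \<mu> \<sigma> \<partial>lborel)"
    proof (cases "\<sigma> > 0")
      case True
      then have "ennreal (rho c1 c2 p ((d - \<mu>) / \<sigma>) * model_pdf n f \<mu> \<sigma> x s * (1 / \<sigma> powr (l + 1)))
          * indicator {0..} \<mu> = E \<mu> \<sigma>" for \<mu>
        using A[of \<mu>] w[of \<mu>]
        unfolding posterior_loss_integrand[OF True] q_def[symmetric]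
          fun_cong[OF A_def, symmetric]
        by (auto simp: E_def w_def h_def indicator_def ennreal_mult' [symmetric])
      with True show ?thesis by simp
    qed (simp add: E_def)
  qed
  also have "\<dots> = (\<integral>\<^sup>+\<mu>. (\<integral>\<^sup>+\<sigma>. E \<mu> \<sigma> \<partial>lborel) \<partial>lborel)"
    unfolding E_def by (rule lborel_pair.Fubini') measurable
  also have "\<dots> = (\<integral>\<^sup>+\<mu>. mixing_const q f *
      (ennreal (w \<mu> * sqrt (A \<mu>) powr (1 - q)) * indicator {0..} \<mu>) \<partial>lborel)"
  proof (rule nn_integral_cong)
    fix \<mu> :: real
    have "(\<integral>\<^sup>+\<sigma>. E \<mu> \<sigma> \<partial>lborel) = ennreal (w \<mu>) * indicator {0..} \<mu> *
        (\<integral>\<^sup>+\<sigma>\<in>{0<..}. ennreal (\<sigma> powr - q * h (A \<mu> / \<sigma>\<^sup>2)) \<partial>lborel)"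
      unfolding E_def by (rule nn_integral_cmult) measurable
    also have "(\<integral>\<^sup>+\<sigma>\<in>{0<..}. ennreal (\<sigma> powr - q * h (A \<mu> / \<sigma>\<^sup>2)) \<partial>lborel)
        = (\<integral>\<^sup>+\<sigma>\<in>{0<..}. ennreal (\<sigma> powr - q * f (A \<mu> / \<sigma>\<^sup>2)) \<partial>lborel)"
      using A[of \<mu>] by (intro nn_integral_cong) (auto simp: h_def indicator_def)
    also have "\<dots> = ennreal (sqrt (A \<mu>) powr (1 - q)) * mixing_const q f"
      using diff A by (rule mixing_integral_scale)
    finally show "(\<integral>\<^sup>+\<sigma>. E \<mu> \<sigma> \<partial>lborel) = mixing_const q f *
        (ennreal (w \<mu> * sqrt (A \<mu>) powr (1 - q)) * indicator {0..} \<mu>)"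
      using w[of \<mu>] by (simp add: ennreal_mult' ac_simps)
  qed
  also have "\<dots> = mixing_const q f *
      (\<integral>\<^sup>+\<mu>\<in>{0..}. ennreal (w \<mu> * sqrt (A \<mu>) powr (1 - q)) \<partial>lborel)"
    by (rule nn_integral_cmult) measurable
  finally show ?thesis
    by (simp add: reduced_loss_def w_def A_def)
qed

text \<open>The integrand vanishes on the half-line only at \<open>\<mu> = d\<close>, a null set.
  This serves to exclude an infinite mixing constant hidden by a zero factor.\<close>

lemma reduced_loss_pos:
  assumes c: "c1 > 0" "c2 > 0" and s: "s > 0"
  shows "reduced_loss n q (rho c1 c2 p) x s d \<noteq> 0"
proof
  assume "reduced_loss n q (rho c1 c2 p) x s d = 0"
  then have "AE \<mu> in lborel. ennreal (rho c1 c2 p (d - \<mu>) * s ^ (n - 1) *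
      sqrt ((x - \<mu>)\<^sup>2 + s\<^sup>2) powr (1 - q)) * indicator {0..} \<mu> = 0"
    unfolding reduced_loss_def by (subst (asm) nn_integral_0_iff_AE) auto
  \<comment> \<open>The unit interval is a sample set of positive measure in the range of \<mu>; it
    would have to be null.\<close>
  then have "AE \<mu> in lborel. \<mu> \<notin> {0..1::real}"
    using AE_lborel_singleton[of d]
  proof eventually_elim
    case (elim \<mu>)
    have "rho c1 c2 p (d - \<mu>) * s ^ (n - 1) * sqrt ((x - \<mu>)\<^sup>2 + s\<^sup>2) powr (1 - q) > 0"
      using c s elim(2) by (intro mult_pos_pos rho_pos) (auto simp: add_nonneg_eq_0_iff)
    with elim(1) show ?case
      by (auto simp: indicator_def ennreal_eq_0_iff split: if_splits)
  qed
  then have "emeasure lborel {0..1::real} = 0"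
    by (subst (asm) AE_iff_measurable[where N = "{0..1}"]) auto
  then show False by simp
qed

text \<open>Existence and uniqueness force the mixing constant to be positive and finite, so it
  cancels from the inequalities between losses.\<close>

lemma is_bayes_action_iff_reduced_loss:
  fixes f :: "real \<Rightarrow> real" and n :: nat and l p :: real
  assumes diff: "\<And>t. t > 0 \<Longrightarrow> f differentiable at t"
    and c: "c1 > 0" "c2 > 0" and s: "s > 0"
    and ex: "gen_bayes_exists n l (rho c1 c2 p) f"
  defines "q \<equiv> p + real n + l + 2"
  shows "is_bayes_action n l (rho c1 c2 p) f x s d \<longleftrightarrow>
    (\<forall>d'. reduced_loss n q (rho c1 c2 p) x s d \<le> reduced_loss n q (rho c1 c2 p) x s d')"
proof -
  have loss: "posterior_loss n l (rho c1 c2 p) f x s d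
      = mixing_const q f * reduced_loss n q (rho c1 c2 p) x s d" for d
    unfolding q_def using diff c s by (rule posterior_loss_factorization)
  obtain d0 where "posterior_loss n l (rho c1 c2 p) f x s d0 < \<infinity>"
    using ex s unfolding gen_bayes_exists_def by blast
  \<comment> \<open>An infinite constant times a nonzero reduced loss would be infinite, even at
    \<open>d0\<close>.\<close>
  then have "mixing_const q f \<noteq> \<infinity>"
    using reduced_loss_pos[OF c s, of n q p x d0] by (auto simp: loss ennreal_top_mult)
  moreover have "mixing_const q f \<noteq> 0"
  proof
    assume "mixing_const q f = 0"
    \<comment> \<open>As \<open>0 * \<infinity> = 0\<close> in \<open>ennreal\<close>, the loss
      would vanish identically; then 0 and 1 would both be minimizers, against uniqueness.\<close>
    then have "is_bayes_action n l (rho c1 c2 p) f x s d" for d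
      by (simp add: is_bayes_action_def loss)
    then show False
      using ex s unfolding gen_bayes_exists_def by (metis zero_neq_one)
  qed
  ultimately show ?thesis
    by (simp add: is_bayes_action_def loss ennreal_mult_le_mult_iff)
qed

theorem lemma3:
  fixes n :: nat and l p c1 c2 :: real and f g :: "real \<Rightarrow> real"
  assumes "n \<ge> 1" and "l \<ge> - (real n - 1)"
    and "p > 0" and "c1 > 0" and "c2 > 0"
    and "admissible_model n f" and "admissible_model n g"
    and "gen_bayes_exists n l (rho c1 c2 p) f"
    and "gen_bayes_exists n l (rho c1 c2 p) g"
  shows "\<forall>x. \<forall>s>0. gen_bayes n l (rho c1 c2 p) f x s = gen_bayes n l (rho c1 c2 p) g x s"
proof (intro allI impI)
  fix x s :: real
  assume "s > 0"
  have "f differentiable at t" "g differentiable at t" if "t > 0" for t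
    using that assms(6,7) by (auto simp: admissible_model_def)
  \<comment> \<open>After rewriting, both definite descriptions select by the same predicate, in
    which neither \<open>f\<close> nor \<open>g\<close> occurs.\<close>
  then show "gen_bayes n l (rho c1 c2 p) f x s = gen_bayes n l (rho c1 c2 p) g x s"
    using assms(4,5,8,9) \<open>s > 0\<close>
    by (simp add: gen_bayes_def is_bayes_action_iff_reduced_loss)
qed

end
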